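(* Let $A$ be a Frobenius algebra over a field $\Bbbk$ with respect to a non-degenerate associative bilinear form $\langle-,-\rangle:A\times A\to\Bbbk$, and let $\sigma:A\to A$ be the corresponding Nakayama automorphism. Then $\sigma$ acts trivially (that is, as the identity) on the Hochschild cohomology $\mathrm{HH}^*(A)$ of $A$, in every degree.
   Context: $\Bbbk$ is a field; algebras are associative and unital over $\Bbbk$. A Frobenius algebra is a finite-dimensional algebra $A$ endowed with a non-degenerate bilinear form $\langle-,-\rangle:A\times A\to\Bbbk$ that is associative: $\langle ab,c\rangle=\langle a,bc\rangle$ for all $a,b,c\in A$. Its Nakayama automorphism is the unique algebra automorphism $\sigma:A\to A$ such that $\langle a,b\rangle=\langle b,\sigma(a)\rangle$ for all $a,b\in A$. The Hochschild cohomology $\mathrm{HH}^*(A)=\mathrm{Ext}^*_{A\otimes A^{\mathrm{op}}}(A,A)$ is the cohomology of the standard Hochschild complex $\mathrm{Hom}_\Bbbk(A^{\otimes *},A)$. An algebra automorphism $\alpha:A\to A$ acts on $\mathrm{HH}^p(A)$ by sending the class of a Hochschild $p$-cocycle $c:A^{\otimes p}\to A$ to the class of the cocycle $c^\alpha$ with $c^\alpha(a_1\otimes\cdots\otimes a_p)=\alpha\bigl(c(\alpha^{-1}(a_1)\otimes\cdots\otimes\alpha^{-1}(a_p))\bigr)$. *)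

theory Defs
  imports Complex_Main
begin

text \<open>The sort \<open>{ring, monoid_mult}\<close> is that of unital associative rings in which \<open>0 = 1\<close> is not
  excluded (unlike \<open>ring_1\<close>), so that the zero algebra is covered.\<close>

locale associative_algebra = vector_space scale
  for scale :: "'k::field \<Rightarrow> 'a::{ring,monoid_mult} \<Rightarrow> 'a" (infixr \<open>*\<^sub>s\<close> 75) +
  assumes scale_mult_left: "(c *\<^sub>s a) * b = c *\<^sub>s (a * b)"
    and scale_mult_right: "a * (c *\<^sub>s b) = c *\<^sub>s (a * b)"

locale frobenius_algebra = associative_algebra scale
  for scale :: "'k::field \<Rightarrow> 'a::{ring,monoid_mult} \<Rightarrow> 'a" (infixr \<open>*\<^sub>s\<close> 75) +
  fixes form :: "'a \<Rightarrow> 'a \<Rightarrow> 'k"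
  assumes finite_dimensional: "\<exists>B. finite B \<and> span B = UNIV"
    and form_linear_left: "Vector_Spaces.linear (*\<^sub>s) (*) (\<lambda>a. form a b)"
    and form_linear_right: "Vector_Spaces.linear (*\<^sub>s) (*) (\<lambda>b. form a b)"
    and form_nondegenerate_left: "(\<And>b. form a b = 0) \<Longrightarrow> a = 0"
    and form_nondegenerate_right: "(\<And>a. form a b = 0) \<Longrightarrow> b = 0"
    and form_assoc: "form (a * b) c = form a (b * c)"

definition algebra_automorphism ::
    "('k::field \<Rightarrow> 'a::{ring,monoid_mult} \<Rightarrow> 'a) \<Rightarrow> ('a \<Rightarrow> 'a) \<Rightarrow> bool"
  where "algebra_automorphism scale \<alpha> \<longleftrightarrow>
    Vector_Spaces.linear scale scale \<alpha> \<and> bij \<alpha> \<and> \<alpha> 1 = 1 \<and> (\<forall>a b. \<alpha> (a * b) = \<alpha> a * \<alpha> b)"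

definition nakayama_automorphism ::
    "('k::field \<Rightarrow> 'a::{ring,monoid_mult} \<Rightarrow> 'a) \<Rightarrow> ('a \<Rightarrow> 'a \<Rightarrow> 'k) \<Rightarrow> ('a \<Rightarrow> 'a) \<Rightarrow> bool"
  where "nakayama_automorphism scale form \<sigma> \<longleftrightarrow>
    algebra_automorphism scale \<sigma> \<and> (\<forall>a b. form a b = form b (\<sigma> a))"

text \<open>A linear map \<open>A\<^sup>\<otimes>\<^sup>p \<rightarrow> A\<close> is given as the corresponding \<open>p\<close>-linear map, whose argument is the
  list \<open>[a\<^sub>1, \<dots>, a\<^sub>p]\<close>. Cochains are \<open>0\<close> on lists of any other length, so that each \<open>p\<close>-linear map is
  represented by exactly one function.\<close>

definition hochschild_cochains ::
    "('k::field \<Rightarrow> 'a::{ring,monoid_mult} \<Rightarrow> 'a) \<Rightarrow> nat \<Rightarrow> ('a list \<Rightarrow> 'a) set"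
  where "hochschild_cochains scale p = {c.
    (\<forall>xs i. length xs = p \<longrightarrow> i < p \<longrightarrow> Vector_Spaces.linear scale scale (\<lambda>x. c (xs[i := x]))) \<and>
    (\<forall>xs. length xs \<noteq> p \<longrightarrow> c xs = 0)}"

text \<open>With list positions counted from \<open>0\<close>, the \<open>i\<close>-th summand of the sum multiplies the entries
  \<open>a\<^bsub>i+1\<^esub>\<close> and \<open>a\<^bsub>i+2\<^esub>\<close>, whence the sign \<open>(-1)\<^bsup>i+1\<^esup>\<close>.\<close>

definition hochschild_differential ::
    "('k::field \<Rightarrow> 'a::{ring,monoid_mult} \<Rightarrow> 'a) \<Rightarrow> nat \<Rightarrow> ('a list \<Rightarrow> 'a) \<Rightarrow> 'a list \<Rightarrow> 'a"
  where "hochschild_differential scale p c xs =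
    (if length xs = p + 1 then
       hd xs * c (tl xs)
       + (\<Sum>i<p. scale ((- 1) ^ (i + 1)) (c (take i xs @ [xs ! i * xs ! (i + 1)] @ drop (i + 2) xs)))
       + scale ((- 1) ^ (p + 1)) (c (butlast xs) * last xs)
     else 0)"

definition hochschild_cocycles ::
    "('k::field \<Rightarrow> 'a::{ring,monoid_mult} \<Rightarrow> 'a) \<Rightarrow> nat \<Rightarrow> ('a list \<Rightarrow> 'a) set"
  where "hochschild_cocycles scale p =
    {c \<in> hochschild_cochains scale p. hochschild_differential scale p c = (\<lambda>_. 0)}"

definition hochschild_coboundaries ::
    "('k::field \<Rightarrow> 'a::{ring,monoid_mult} \<Rightarrow> 'a) \<Rightarrow> nat \<Rightarrow> ('a list \<Rightarrow> 'a) set"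
  where "hochschild_coboundaries scale p =
    (case p of 0 \<Rightarrow> {\<lambda>_. 0}
     | Suc q \<Rightarrow> hochschild_differential scale q ` hochschild_cochains scale q)"

definition cohomologous ::
    "('k::field \<Rightarrow> 'a::{ring,monoid_mult} \<Rightarrow> 'a) \<Rightarrow> nat \<Rightarrow> (('a list \<Rightarrow> 'a) \<times> ('a list \<Rightarrow> 'a)) set"
  where "cohomologous scale p =
    {(c, d). c \<in> hochschild_cocycles scale p \<and> d \<in> hochschild_cocycles scale p \<and>
       (\<lambda>xs. c xs - d xs) \<in> hochschild_coboundaries scale p}"

definition hochschild_cohomology ::
    "('k::field \<Rightarrow> 'a::{ring,monoid_mult} \<Rightarrow> 'a) \<Rightarrow> nat \<Rightarrow> ('a list \<Rightarrow> 'a) set set"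
  where "hochschild_cohomology scale p = hochschild_cocycles scale p // cohomologous scale p"

definition conj_cochain ::
    "('a \<Rightarrow> 'a) \<Rightarrow> ('a list \<Rightarrow> 'a) \<Rightarrow> 'a list \<Rightarrow> 'a"
  where "conj_cochain \<alpha> c xs = \<alpha> (c (map (inv \<alpha>) xs))"

definition hochschild_action ::
    "('k::field \<Rightarrow> 'a::{ring,monoid_mult} \<Rightarrow> 'a) \<Rightarrow> nat \<Rightarrow> ('a \<Rightarrow> 'a) \<Rightarrow>
      ('a list \<Rightarrow> 'a) set \<Rightarrow> ('a list \<Rightarrow> 'a) set"
  where "hochschild_action scale p \<alpha> \<xi> = (\<Union>c\<in>\<xi>. cohomologous scale p `` {conj_cochain \<alpha> c})"


subsection \<open>The Nakayama automorphism exists and is unique\<close>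

context frobenius_algebra
begin

lemma form_add_left: "form (a + a') b = form a b + form a' b"
  and form_scale_left: "form (k *\<^sub>s a) b = k * form a b"
  using form_linear_left[of b]
  by (auto simp: Vector_Spaces.linear_def module_hom_def module_hom_axioms_def)

lemma form_add_right: "form a (b + b') = form a b + form a b'"
  and form_scale_right: "form a (k *\<^sub>s b) = k * form a b"
  using form_linear_right[of a]
  by (auto simp: Vector_Spaces.linear_def module_hom_def module_hom_axioms_def)

lemma form_diff_right: "form a (b - b') = form a b - form a b'"
  using form_add_right[of a "b - b'" b'] by simp

lemma form_eq_right: "(\<And>a. form a b = form a b') \<Longrightarrow> b = b'"
  using form_nondegenerate_right[of "b - b'"] by (simp add: form_diff_right)

lemma finite_basis_exists:
  obtains B where "finite B" "independent B" "span B = UNIV"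
proof -
  obtain B0 where B0: "finite B0" "span B0 = UNIV" using finite_dimensional by blast
  obtain B where B: "B \<subseteq> B0" "independent B" "B0 \<subseteq> span B"
    using maximal_independent_subset by blast
  have "span B = UNIV" using span_mono[OF B(3)] B0(2) by (simp add: span_span top.extremum_unique)
  with B B0(1) show thesis using that finite_subset by blast
qed

lemma linear_inj_imp_surj:
  assumes "Vector_Spaces.linear (*\<^sub>s) (*\<^sub>s) f" "inj f"
  shows "surj f"
proof -
  obtain B where B: "finite B" "independent B" "span B = UNIV" using finite_basis_exists .
  interpret fd: finite_dimensional_vector_space "(*\<^sub>s)" B
    by unfold_locales (use B in auto)
  show ?thesis using assms by (rule fd.linear_inj_imp_surj)
qed

lemma form_represents:
  assumes "Vector_Spaces.linear (*\<^sub>s) (*) \<phi>"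
  shows "\<exists>x. \<forall>b. \<phi> b = form b x"
proof -
  obtain B where B: "finite B" "independent B" "span B = UNIV" using finite_basis_exists .
  define F where "F x = (\<Sum>e\<in>B. form e x *\<^sub>s e)" for x
  have lin: "Vector_Spaces.linear (*\<^sub>s) (*\<^sub>s) F"
    by unfold_locales
      (auto simp: F_def form_add_right form_scale_right scale_left_distrib sum.distrib scale_sum_right)
  have indep: "\<forall>e\<in>B. u e = v e" if "(\<Sum>e\<in>B. u e *\<^sub>s e) = (\<Sum>e\<in>B. v e *\<^sub>s e)" for u v
  proof -
    have "(\<Sum>e\<in>B. (u e - v e) *\<^sub>s e) = 0"
      using that by (simp add: scale_left_diff_distrib sum_subtractf)
    then show ?thesis
      using independentD[OF B(2) B(1) subset_refl, of "\<lambda>e. u e - v e"] by auto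
  qed
  have ext: "\<phi> b = form b x" if "\<forall>e\<in>B. \<phi> e = form e x"
    and l: "Vector_Spaces.linear (*\<^sub>s) (*) \<phi>" for \<phi> b x
  proof -
    interpret p: vector_space_pair "(*\<^sub>s)" "(*) :: 'k \<Rightarrow> 'k \<Rightarrow> 'k"
      using l form_linear_left by (simp add: Vector_Spaces.linear_def vector_space_pair_def)
    show ?thesis
      using p.linear_eq_on[OF l form_linear_left, of b B x] that B by auto
  qed
  have zero: "Vector_Spaces.linear (*\<^sub>s) (*) (\<lambda>b. form b y)" for y
    by (rule form_linear_left)
  have "inj F"
  proof (rule injI)
    fix x y assume "F x = F y"
    then have "\<forall>e\<in>B. form e x = form e y" unfolding F_def by (rule indep)
    then have "form b x = form b y" for b using ext[OF _ zero[of x]] by blast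
    then show "x = y" by (rule form_eq_right)
  qed
  then obtain x where "F x = (\<Sum>e\<in>B. \<phi> e *\<^sub>s e)"
    using linear_inj_imp_surj[OF lin] by (metis surjD)
  then have "\<forall>e\<in>B. \<phi> e = form e x" unfolding F_def using indep by metis
  then show ?thesis using ext[OF _ assms] by blast
qed

lemma nakayama_automorphism_ex1: "\<exists>!\<sigma>. nakayama_automorphism (*\<^sub>s) form \<sigma>"
proof -
  obtain \<sigma> where \<sigma>: "form a b = form b (\<sigma> a)" for a b
    using form_represents[OF form_linear_right] by metis
  have lin: "Vector_Spaces.linear (*\<^sub>s) (*\<^sub>s) \<sigma>"
  proof unfold_locales
    show "\<sigma> (a + a') = \<sigma> a + \<sigma> a'" for a a'
      by (rule form_eq_right) (simp add: form_add_right form_add_left flip: \<sigma>)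
    show "\<sigma> (k *\<^sub>s a) = k *\<^sub>s \<sigma> a" for k a
      by (rule form_eq_right) (simp add: form_scale_right form_scale_left flip: \<sigma>)
  qed
  have one: "\<sigma> 1 = 1"
    by (rule form_eq_right) (metis \<sigma> form_assoc mult_1_left mult_1_right)
  have mult: "\<sigma> (a * c) = \<sigma> a * \<sigma> c" for a c
    by (rule form_eq_right) (metis \<sigma> form_assoc)
  have "inj \<sigma>"
  proof (rule injI)
    fix a a' assume eq: "\<sigma> a = \<sigma> a'"
    have "form (a - a') b = 0" for b
      using \<sigma>[of a b] \<sigma>[of a' b] eq form_add_left[of "a - a'" a' b] by simp
    then show "a = a'" using form_nondegenerate_left[of "a - a'"] by simp
  qed
  with linear_inj_imp_surj[OF lin] have "bij \<sigma>" by (simp add: bij_def)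
  then have "nakayama_automorphism (*\<^sub>s) form \<sigma>"
    unfolding nakayama_automorphism_def algebra_automorphism_def using lin one mult \<sigma> by blast
  moreover have "\<tau> = \<sigma>" if "nakayama_automorphism (*\<^sub>s) form \<tau>" for \<tau>
    using that \<sigma> unfolding nakayama_automorphism_def by (metis form_eq_right ext)
  ultimately show ?thesis by blast
qed

end


subsection \<open>The action on cohomology is well defined\<close>

context associative_algebra
begin

lemma hochschild_cochains_diff:
  assumes "c \<in> hochschild_cochains (*\<^sub>s) p" "d \<in> hochschild_cochains (*\<^sub>s) p"
  shows "(\<lambda>xs. c xs - d xs) \<in> hochschild_cochains (*\<^sub>s) p"
proof -
  interpret vector_space_pair "(*\<^sub>s)" "(*\<^sub>s)" by unfold_locales
  show ?thesis using assms by (auto simp: hochschild_cochains_def intro: linear_compose_sub)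
qed

lemma hochschild_differential_diff:
  "hochschild_differential (*\<^sub>s) p (\<lambda>xs. c xs - d xs) =
    (\<lambda>xs. hochschild_differential (*\<^sub>s) p c xs - hochschild_differential (*\<^sub>s) p d xs)"
  by (auto simp: hochschild_differential_def fun_eq_iff algebra_simps scale_right_diff_distrib
      sum_subtractf sum_negf)

lemma zero_in_hochschild_cochains: "(\<lambda>_. 0) \<in> hochschild_cochains (*\<^sub>s) p"
proof -
  interpret vector_space_pair "(*\<^sub>s)" "(*\<^sub>s)" by unfold_locales
  show ?thesis by (simp add: hochschild_cochains_def linear_zero)
qed

lemma zero_in_hochschild_coboundaries: "(\<lambda>_. 0) \<in> hochschild_coboundaries (*\<^sub>s) p"
proof (cases p)
  case (Suc q)
  have "hochschild_differential (*\<^sub>s) q (\<lambda>_. 0) = (\<lambda>_. 0)"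
    by (auto simp: hochschild_differential_def fun_eq_iff)
  then show ?thesis
    using zero_in_hochschild_cochains[of q] Suc
    by (force simp: hochschild_coboundaries_def)
qed (simp add: hochschild_coboundaries_def)

lemma hochschild_coboundaries_diff:
  assumes "c \<in> hochschild_coboundaries (*\<^sub>s) p" "d \<in> hochschild_coboundaries (*\<^sub>s) p"
  shows "(\<lambda>xs. c xs - d xs) \<in> hochschild_coboundaries (*\<^sub>s) p"
proof (cases p)
  case (Suc q)
  then obtain c' d' where "c = hochschild_differential (*\<^sub>s) q c'" "c' \<in> hochschild_cochains (*\<^sub>s) q"
    "d = hochschild_differential (*\<^sub>s) q d'" "d' \<in> hochschild_cochains (*\<^sub>s) q"
    using assms by (auto simp: hochschild_coboundaries_def)
  then show ?thesis
    unfolding Suc hochschild_coboundaries_def nat.case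
    by (intro image_eqI[where x = "\<lambda>xs. c' xs - d' xs"])
      (simp_all add: hochschild_differential_diff hochschild_cochains_diff)
qed (use assms in \<open>auto simp: hochschild_coboundaries_def\<close>)

lemma equiv_cohomologous: "equiv (hochschild_cocycles (*\<^sub>s) p) (cohomologous (*\<^sub>s) p)"
proof (rule equivI)
  show "cohomologous (*\<^sub>s) p \<subseteq> hochschild_cocycles (*\<^sub>s) p \<times> hochschild_cocycles (*\<^sub>s) p"
    by (auto simp: cohomologous_def)
  show "refl_on (hochschild_cocycles (*\<^sub>s) p) (cohomologous (*\<^sub>s) p)"
    by (auto simp: refl_on_def cohomologous_def zero_in_hochschild_coboundaries)
  show sym: "sym (cohomologous (*\<^sub>s) p)"
  proof (rule symI)
    fix c d assume "(c, d) \<in> cohomologous (*\<^sub>s) p"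
    then show "(d, c) \<in> cohomologous (*\<^sub>s) p"
      using hochschild_coboundaries_diff[OF zero_in_hochschild_coboundaries, of "\<lambda>xs. c xs - d xs"]
      by (simp add: cohomologous_def)
  qed
  show "trans (cohomologous (*\<^sub>s) p)"
  proof (rule transI)
    fix c d e assume "(c, d) \<in> cohomologous (*\<^sub>s) p" and "(d, e) \<in> cohomologous (*\<^sub>s) p"
    moreover from this have "(e, d) \<in> cohomologous (*\<^sub>s) p" using sym by (meson symD)
    ultimately show "(c, e) \<in> cohomologous (*\<^sub>s) p"
      using hochschild_coboundaries_diff[of "\<lambda>xs. c xs - d xs" p "\<lambda>xs. e xs - d xs"]
      by (simp add: cohomologous_def)
  qed
qed

context
  fixes \<alpha> :: "'a \<Rightarrow> 'a"
  assumes \<alpha>: "algebra_automorphism (*\<^sub>s) \<alpha>"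
begin

lemma automorphism_linear: "Vector_Spaces.linear (*\<^sub>s) (*\<^sub>s) \<alpha>"
  and automorphism_bij: "bij \<alpha>"
  and automorphism_mult: "\<alpha> (a * b) = \<alpha> a * \<alpha> b"
  using \<alpha> by (auto simp: algebra_automorphism_def)

lemma automorphism_inv_f: "\<alpha> (inv \<alpha> a) = a" "inv \<alpha> (\<alpha> a) = a"
  using automorphism_bij by (auto simp: bij_def surj_f_inv_f)

lemma automorphism_inv_mult: "inv \<alpha> (a * b) = inv \<alpha> a * inv \<alpha> b"
  by (metis automorphism_inv_f automorphism_mult)

lemma automorphism_inv_linear: "Vector_Spaces.linear (*\<^sub>s) (*\<^sub>s) (inv \<alpha>)"
proof -
  interpret l: Vector_Spaces.linear "(*\<^sub>s)" "(*\<^sub>s)" \<alpha> by (rule automorphism_linear)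
  show ?thesis
    by unfold_locales (metis automorphism_inv_f l.add l.scale)+
qed

lemma conj_cochain_in_cochains:
  assumes "c \<in> hochschild_cochains (*\<^sub>s) p"
  shows "conj_cochain \<alpha> c \<in> hochschild_cochains (*\<^sub>s) p"
proof -
  interpret l: Vector_Spaces.linear "(*\<^sub>s)" "(*\<^sub>s)" \<alpha> by (rule automorphism_linear)
  have "Vector_Spaces.linear (*\<^sub>s) (*\<^sub>s) (\<lambda>x. conj_cochain \<alpha> c (xs[i := x]))"
    if "length xs = p" "i < p" for xs i
  proof -
    have "Vector_Spaces.linear (*\<^sub>s) (*\<^sub>s) (\<lambda>x. c ((map (inv \<alpha>) xs)[i := x]))"
      using assms that by (simp add: hochschild_cochains_def)
    then have "Vector_Spaces.linear (*\<^sub>s) (*\<^sub>s) (\<alpha> \<circ> ((\<lambda>x. c ((map (inv \<alpha>) xs)[i := x])) \<circ> inv \<alpha>))"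
      by (intro Vector_Spaces.linear_compose[OF _ automorphism_linear]
          Vector_Spaces.linear_compose[OF automorphism_inv_linear])
    then show ?thesis by (simp add: conj_cochain_def[abs_def] map_update o_def)
  qed
  then show ?thesis using assms l.zero by (simp add: hochschild_cochains_def conj_cochain_def)
qed

lemma hochschild_differential_conj:
  "hochschild_differential (*\<^sub>s) p (conj_cochain \<alpha> c) =
    conj_cochain \<alpha> (hochschild_differential (*\<^sub>s) p c)"
proof
  fix xs :: "'a list"
  interpret l: Vector_Spaces.linear "(*\<^sub>s)" "(*\<^sub>s)" \<alpha> by (rule automorphism_linear)
  show "hochschild_differential (*\<^sub>s) p (conj_cochain \<alpha> c) xs =
    conj_cochain \<alpha> (hochschild_differential (*\<^sub>s) p c) xs"
  proof (cases "length xs = p + 1")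
    case True
    then have "xs \<noteq> []" by auto
    with True show ?thesis
      by (simp add: hochschild_differential_def conj_cochain_def l.add l.diff l.neg l.scale l.sum
          automorphism_mult automorphism_inv_f automorphism_inv_mult hd_map last_map
          map_tl map_butlast take_map drop_map)
  qed (simp add: hochschild_differential_def conj_cochain_def l.zero)
qed

lemma conj_cochain_in_cocycles:
  assumes "c \<in> hochschild_cocycles (*\<^sub>s) p"
  shows "conj_cochain \<alpha> c \<in> hochschild_cocycles (*\<^sub>s) p"
proof -
  interpret l: Vector_Spaces.linear "(*\<^sub>s)" "(*\<^sub>s)" \<alpha> by (rule automorphism_linear)
  show ?thesis using assms
    by (auto simp: hochschild_cocycles_def conj_cochain_in_cochains hochschild_differential_conj)
      (simp add: conj_cochain_def[abs_def] l.zero)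
qed

lemma conj_cochain_congruent:
  "congruent (cohomologous (*\<^sub>s) p) (\<lambda>c. cohomologous (*\<^sub>s) p `` {conj_cochain \<alpha> c})"
proof (rule congruentI)
  fix c d assume cd: "(c, d) \<in> cohomologous (*\<^sub>s) p"
  interpret l: Vector_Spaces.linear "(*\<^sub>s)" "(*\<^sub>s)" \<alpha> by (rule automorphism_linear)
  have diff: "(\<lambda>xs. conj_cochain \<alpha> c xs - conj_cochain \<alpha> d xs) = conj_cochain \<alpha> (\<lambda>xs. c xs - d xs)"
    by (simp add: conj_cochain_def[abs_def] l.diff)
  have "conj_cochain \<alpha> b \<in> hochschild_coboundaries (*\<^sub>s) p"
    if "b \<in> hochschild_coboundaries (*\<^sub>s) p" for b
    using that
    by (cases p) (auto simp: hochschild_coboundaries_def conj_cochain_in_cochains l.zero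
        conj_cochain_def[of \<alpha> "\<lambda>_. 0", abs_def] simp flip: hochschild_differential_conj)
  with cd have "(conj_cochain \<alpha> c, conj_cochain \<alpha> d) \<in> cohomologous (*\<^sub>s) p"
    by (simp add: cohomologous_def conj_cochain_in_cocycles diff)
  then show "cohomologous (*\<^sub>s) p `` {conj_cochain \<alpha> c} = cohomologous (*\<^sub>s) p `` {conj_cochain \<alpha> d}"
    by (rule equiv_class_eq[OF equiv_cohomologous])
qed

lemma hochschild_action_class:
  assumes "c \<in> hochschild_cocycles (*\<^sub>s) p"
  shows "hochschild_action (*\<^sub>s) p \<alpha> (cohomologous (*\<^sub>s) p `` {c}) =
    cohomologous (*\<^sub>s) p `` {conj_cochain \<alpha> c}"
  unfolding hochschild_action_def
  by (rule UN_equiv_class[OF equiv_cohomologous conj_cochain_congruent assms])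

end

end

end

theory Submission
  imports Defs
begin

text \<open>Put \<open>\<tau> = \<sigma>\<^sup>-\<^sup>1\<close>. The form turns a cochain \<open>c\<close> into the functional
  \<open>f(a\<^sub>0, \<dots>, a\<^sub>p) = \<langle>a\<^sub>0, c(a\<^sub>1, \<dots>, a\<^sub>p)\<rangle>\<close>, the Hochschild differential into the dual of
  \<open>b = \<Sum>\<^sub>i (-1)\<^sup>i d\<^sub>i\<close>, whose last face multiplies \<open>\<tau>(a\<^sub>n) a\<^sub>0\<close>, and the action of \<open>\<sigma>\<close> into
  precomposition with \<open>\<tau>\<close> in all arguments. The faces and the rotation
  \<open>t(a\<^sub>0, \<dots>, a\<^sub>n) = (\<tau>(a\<^sub>n), a\<^sub>0, \<dots>, a\<^bsub>n-1\<^esub>)\<close> form a paracyclic object in which \<open>t\<^bsup>n+1\<^esup>\<close> is \<open>\<tau>\<close>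
  in all arguments. With \<open>T = (-1)\<^sup>n t\<close>, \<open>N = \<Sum>\<^bsub>j\<le>n\<^esub> T\<^sup>j\<close>, \<open>b'\<close> the sum \<open>b\<close> without its last face,
  and \<open>s(a\<^sub>0, \<dots>, a\<^sub>n) = (1, a\<^sub>0, \<dots>, a\<^sub>n)\<close>, Connes' identities \<open>b(1 - T) = (1 - T)b'\<close>, \<open>b'N = Nb\<close>
  and \<open>b's + sb' = 1\<close> do not need \<open>t\<^bsup>n+1\<^esup> = 1\<close>. Hence \<open>B = (1 - T)sN\<close> satisfies
  \<open>bB + Bb = (1 - T)N = 1 - T\<^bsup>n+1\<^esup>\<close>, so \<open>B\<close> is a homotopy between the identity and the action
  of \<open>\<sigma>\<close>.\<close>

section \<open>Twisted rotations and faces\<close>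

context
  fixes \<tau> :: "'a::monoid_mult \<Rightarrow> 'a"
begin

definition twisted_rotation :: "'a list \<Rightarrow> 'a list"
  where "twisted_rotation xs = \<tau> (last xs) # butlast xs"

text \<open>The inner faces are spelled as in \<open>hochschild_differential\<close>, so that
  unfolding compares the two. Every index from \<open>length xs - 1\<close> on gives the last,
  twisted face; on a singleton it does not shorten the list.\<close>

definition face :: "nat \<Rightarrow> 'a list \<Rightarrow> 'a list"
  where "face i xs =
    (if Suc i < length xs then take i xs @ [xs ! i * xs ! (i + 1)] @ drop (i + 2) xs
     else \<tau> (last xs) * hd xs # tl (butlast xs))"

lemma length_twisted_rotation [simp]: "xs \<noteq> [] \<Longrightarrow> length (twisted_rotation xs) = length xs"
  by (simp add: twisted_rotation_def)

lemma twisted_rotation_neq_Nil [simp]: "twisted_rotation xs \<noteq> []"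
  by (simp add: twisted_rotation_def)

lemma length_twisted_rotation_funpow [simp]:
  "xs \<noteq> [] \<Longrightarrow> length ((twisted_rotation ^^ j) xs) = length xs"
  by (induction j) (auto simp flip: length_greater_0_conv)

lemma length_face [simp]: "2 \<le> length xs \<Longrightarrow> length (face i xs) = length xs - 1"
  by (auto simp: face_def)

text \<open>Within one full turn each of the last \<open>j\<close> entries moves to the front
  exactly once and so picks up exactly one \<tau>.\<close>

lemma twisted_rotation_funpow:
  assumes "j \<le> length xs"
  shows "(twisted_rotation ^^ j) xs =
    map \<tau> (drop (length xs - j) xs) @ take (length xs - j) xs"
  using assms
proof (induction j)
  case (Suc j)
  define m where "m = length xs - Suc j"
  have m: "length xs - j = Suc m" "m < length xs" using Suc.prems by (auto simp: m_def)
  have "drop m xs = xs ! m # drop (Suc m) xs" "take (Suc m) xs = take m xs @ [xs ! m]"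
    using m by (simp_all add: Cons_nth_drop_Suc take_Suc_conv_app_nth)
  then show ?case using Suc m
    by (simp add: twisted_rotation_def butlast_append flip: m_def)
qed simp

lemma twisted_rotation_funpow_length: "(twisted_rotation ^^ length xs) xs = map \<tau> xs"
  by (simp add: twisted_rotation_funpow)

lemma face_Cons: "Suc i < length xs \<Longrightarrow> face (Suc i) (x # xs) = x # face i xs"
  by (simp add: face_def)

lemma face_append: "Suc i < length xs \<Longrightarrow> face i (xs @ ys) = face i xs @ ys"
  by (simp add: face_def nth_append)

lemma face_0_one: "xs \<noteq> [] \<Longrightarrow> face 0 (1 # xs) = xs"
  by (cases xs) (simp_all add: face_def)

lemma face_0_twisted_rotation:
  assumes "length xs = Suc n" "1 \<le> n"
  shows "face 0 (twisted_rotation xs) = face n xs"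
proof -
  obtain x ys where xs: "xs = x # ys" "ys \<noteq> []" using assms by (cases xs) fastforce+
  then obtain zs z where "ys = zs @ [z]" by (metis rev_exhaust)
  with xs assms show ?thesis by (simp add: face_def twisted_rotation_def butlast_append)
qed

context
  assumes \<tau>_mult: "\<And>a b. \<tau> (a * b) = \<tau> a * \<tau> b"
begin

text \<open>Rotation moves an inner product one place to the right. For \<open>i = n - 1\<close> the
  product reaches the front instead: the last face then multiplies two twisted entries, and
  multiplicativity of \<tau> joins them.\<close>

lemma face_Suc_twisted_rotation:
  assumes "length xs = Suc n" "i < n"
  shows "face (Suc i) (twisted_rotation xs) = twisted_rotation (face i xs)"
proof -
  obtain ys z where xs: "xs = ys @ [z]" "length ys = n" using assms(1) by (cases xs rule: rev_cases) auto
  show ?thesis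
  proof (cases "Suc i < n")
    case True
    then have "face i xs = face i ys @ [z]" using xs by (simp add: face_append)
    then show ?thesis using True xs by (simp add: twisted_rotation_def face_Cons)
  next
    case False
    then have n: "n = Suc i" using assms(2) by simp
    then obtain us y where "ys = us @ [y]" "length us = i" using xs(2) by (cases ys rule: rev_cases) auto
    then show ?thesis using xs n by (simp add: twisted_rotation_def face_def \<tau>_mult nth_append butlast_append)
  qed
qed

lemma face_twisted_rotation_funpow_ge:
  assumes "length xs = Suc n" "j \<le> i" "i \<le> n" "1 \<le> n"
  shows "face i ((twisted_rotation ^^ j) xs) = (twisted_rotation ^^ j) (face (i - j) xs)"
  using assms(2,3)
proof (induction j arbitrary: i)
  case (Suc j)
  then obtain k where k: "i = Suc k" by (cases i) auto
  have "length ((twisted_rotation ^^ j) xs) = Suc n"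
    using assms(1) by (subst length_twisted_rotation_funpow) auto
  with Suc k show ?case by (simp add: face_Suc_twisted_rotation)
qed simp

text \<open>Pulling out \<open>i\<close> rotations lowers the face index to 0. The next rotation is
  absorbed by \<open>face_0_twisted_rotation\<close>, which resets the index to \<open>n\<close>;
  the remaining \<open>j - i - 1\<close> are pulled out as before.\<close>

lemma face_twisted_rotation_funpow_less:
  assumes "length xs = Suc n" "i < j" "j \<le> n" "1 \<le> n"
  shows "face i ((twisted_rotation ^^ j) xs) = (twisted_rotation ^^ (j - 1)) (face (n + 1 + i - j) xs)"
proof -
  let ?t = twisted_rotation
  define k where "k = j - Suc i"
  have j: "j = i + Suc k" using assms(2) by (simp add: k_def)
  have ne: "xs \<noteq> []" using assms(1) by auto
  have len: "length ((?t ^^ m) xs) = Suc n" for m using ne assms(1) by simp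
  have "face i ((?t ^^ j) xs) = face i ((?t ^^ i) ((?t ^^ Suc k) xs))"
    unfolding j funpow_add by simp
  also have "\<dots> = (?t ^^ i) (face 0 ((?t ^^ Suc k) xs))"
    using face_twisted_rotation_funpow_ge[of "(?t ^^ Suc k) xs" n i i] len[of "Suc k"] assms by simp
  also have "face 0 ((?t ^^ Suc k) xs) = face n ((?t ^^ k) xs)"
    using face_0_twisted_rotation[of "(?t ^^ k) xs" n] len[of k] assms by simp
  also have "\<dots> = (?t ^^ k) (face (n - k) xs)"
    using assms j by (intro face_twisted_rotation_funpow_ge) auto
  also have "(?t ^^ i) \<dots> = (?t ^^ (j - 1)) (face (n - k) xs)"
    by (simp add: j funpow_add)
  also have "n - k = n + 1 + i - j" using j by simp
  finally show ?thesis .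
qed

end

section \<open>The paracyclic operators on functionals\<close>

text \<open>These are the duals of \<open>T\<close>, \<open>N\<close>, \<open>b\<close>, \<open>b'\<close> and \<open>B\<close>, so all compositions are reversed. The
  degree of a functional is read off the length of its argument, which is one more than \<open>n\<close>.\<close>

definition cyclic_op :: "('a list \<Rightarrow> 'k::comm_ring_1) \<Rightarrow> 'a list \<Rightarrow> 'k"
  where "cyclic_op f xs = (- 1) ^ (length xs - 1) * f (twisted_rotation xs)"

definition norm_op :: "('a list \<Rightarrow> 'k::comm_ring_1) \<Rightarrow> 'a list \<Rightarrow> 'k"
  where "norm_op f xs =
    (\<Sum>j<length xs. (- 1) ^ ((length xs - 1) * j) * f ((twisted_rotation ^^ j) xs))"

definition twisted_differential :: "('a list \<Rightarrow> 'k::comm_ring_1) \<Rightarrow> 'a list \<Rightarrow> 'k"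
  where "twisted_differential f xs = (\<Sum>i<length xs. (- 1) ^ i * f (face i xs))"

definition bar_op :: "('a list \<Rightarrow> 'k::comm_ring_1) \<Rightarrow> 'a list \<Rightarrow> 'k"
  where "bar_op f xs = (\<Sum>i<length xs - 1. (- 1) ^ i * f (face i xs))"

definition connes_op :: "('a list \<Rightarrow> 'k::comm_ring_1) \<Rightarrow> 'a list \<Rightarrow> 'k"
  where "connes_op f = norm_op (\<lambda>xs. f (1 # xs) - cyclic_op f (1 # xs))"

section \<open>Connes' identities in dual form\<close>

lemma norm_op_cong:
  assumes "xs \<noteq> []" "\<And>ys. length ys = length xs \<Longrightarrow> f ys = g ys"
  shows "norm_op f xs = norm_op g xs"
  using assms by (simp add: norm_op_def)

text \<open>The sum telescopes to the terms with 0 and \<open>n + 1\<close> rotations; the latter is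
  a full turn, with sign \<open>(-1)^(n * (n + 1)) = 1\<close>.\<close>

lemma norm_op_one_minus_cyclic_op:
  assumes "xs \<noteq> []"
  shows "norm_op (\<lambda>ys. f ys - cyclic_op f ys) xs = f xs - f (map \<tau> xs)"
proof -
  obtain n where n: "length xs = Suc n" using assms by (cases xs) auto
  define u where "u j = (- 1) ^ (n * j) * f ((twisted_rotation ^^ j) xs)" for j
  have "norm_op (\<lambda>ys. f ys - cyclic_op f ys) xs = (\<Sum>j<Suc n. u j - u (Suc j))"
    unfolding norm_op_def n
    by (rule sum.cong) (use assms n in \<open>auto simp: u_def cyclic_op_def algebra_simps power_add\<close>)
  also have "\<dots> = u 0 - u (Suc n)" by (rule sum_lessThan_telescope')
  also have "u (Suc n) = f (map \<tau> xs)"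
  proof -
    have "even (n * Suc n)" by simp
    then have "(- 1 :: 'b) ^ (n * Suc n) = 1" by (rule neg_one_even_power)
    then show ?thesis using twisted_rotation_funpow_length[of xs]
      unfolding u_def n by simp
  qed
  finally show ?thesis by (simp add: u_def)
qed

text \<open>Face 0 deletes the unit in front; the other inner faces of \<open>1 # xs\<close> are
  those of \<open>xs\<close> with the index raised by one, hence with opposite sign.\<close>

lemma bar_op_homotopy:
  assumes "xs \<noteq> []"
  shows "bar_op (\<lambda>ys. f (1 # ys)) xs = f xs - bar_op f (1 # xs)"
proof -
  obtain n where n: "length xs = Suc n" using assms by (cases xs) auto
  have "bar_op f (1 # xs) = f xs + (\<Sum>i<n. (- 1) ^ Suc i * f (face (Suc i) (1 # xs)))"
    using assms n by (simp add: bar_op_def sum.lessThan_Suc_shift face_0_one del: sum.lessThan_Suc)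
  also have "(\<Sum>i<n. (- 1) ^ Suc i * f (face (Suc i) (1 # xs))) = - bar_op (\<lambda>ys. f (1 # ys)) xs"
    using n by (simp add: bar_op_def face_Cons sum_negf)
  finally show ?thesis by simp
qed

context
  assumes \<tau>_mult: "\<And>a b. \<tau> (a * b) = \<tau> a * \<tau> b"
begin

text \<open>Both terms on the right contain the last face of \<open>xs\<close> with the same sign,
  the second one as face 0 of the rotated list. It cancels, and only inner faces remain.\<close>

lemma bar_op_one_minus_cyclic_op:
  assumes "2 \<le> length xs"
  shows "bar_op (\<lambda>ys. f ys - cyclic_op f ys) xs =
    twisted_differential f xs - cyclic_op (twisted_differential f) xs"
proof -
  obtain n where n: "length xs = Suc (Suc n)"
    using assms by (metis Suc_le_D add_2_eq_Suc le_Suc_ex)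
  then have ne: "xs \<noteq> []" by auto
  have "cyclic_op (twisted_differential f) xs =
      - ((- 1) ^ n * f (face 0 (twisted_rotation xs))
        - (\<Sum>i<Suc n. (- 1) ^ (n + i) * f (face (Suc i) (twisted_rotation xs))))"
    unfolding cyclic_op_def twisted_differential_def length_twisted_rotation[OF ne] n
      sum.lessThan_Suc_shift[of _ "Suc n"]
    by (simp add: algebra_simps sum_negf sum_distrib_left power_add del: sum.lessThan_Suc)
  also have "face 0 (twisted_rotation xs) = face (Suc n) xs"
    using n by (intro face_0_twisted_rotation) auto
  also have "(\<Sum>i<Suc n. (- 1) ^ (n + i) * f (face (Suc i) (twisted_rotation xs))) =
      bar_op (cyclic_op f) xs"
    unfolding bar_op_def n
    by (rule sum.cong)
      (use n in \<open>auto simp: cyclic_op_def face_Suc_twisted_rotation[OF \<tau>_mult n] power_add algebra_simps\<close>)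
  finally have "cyclic_op (twisted_differential f) xs =
    bar_op (cyclic_op f) xs - (- 1) ^ n * f (face (Suc n) xs)" by simp
  moreover have "twisted_differential f xs = bar_op f xs - (- 1) ^ n * f (face (Suc n) xs)"
    by (simp add: twisted_differential_def bar_op_def n)
  moreover have "bar_op (\<lambda>ys. f ys - cyclic_op f ys) xs = bar_op f xs - bar_op (cyclic_op f) xs"
    by (simp add: bar_op_def algebra_simps sum_subtractf)
  ultimately show ?thesis by simp
qed

lemma norm_op_bar_op:
  assumes "2 \<le> length xs"
  shows "norm_op (bar_op f) xs = twisted_differential (norm_op f) xs"
proof -
  obtain n where n: "length xs = Suc n" "1 \<le> n"
    using assms by (cases xs) auto
  then have ne: "xs \<noteq> []" by auto
  let ?t = twisted_rotation
  let ?L = "\<lambda>(j, i). (- 1) ^ (n * j + i) * f (face i ((?t ^^ j) xs))"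
  let ?R = "\<lambda>(k, l). (- 1) ^ ((n - 1) * k + l) * f ((?t ^^ k) (face l xs))"
  have "norm_op (bar_op f) xs = (\<Sum>j<Suc n. \<Sum>i<n. ?L (j, i))"
    unfolding norm_op_def bar_op_def using ne
    by (simp add: n sum_distrib_left power_add mult.assoc del: sum.lessThan_Suc)
  also have "\<dots> = (\<Sum>x\<in>{..<Suc n} \<times> {..<n}. ?L x)"
    unfolding sum.cartesian_product by (simp add: split_beta)
  also have "\<dots> = (\<Sum>x\<in>{..<n} \<times> {..<Suc n}. ?R x)"
  \<comment> \<open>The map on index pairs is dictated by the two rules for moving a face past
    rotations. Since \<open>k + l\<close> is \<open>i\<close> in the first case and
    \<open>n + i\<close> in the second, comparing it with \<open>n\<close> inverts the map. The sign
    exponents differ by even numbers.\<close>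
  proof (rule sum.reindex_bij_witness[where
        i = "\<lambda>(k, l). if k + l < n then (k, k + l) else (Suc k, k + l - n)" and
        j = "\<lambda>(j, i). if j \<le> i then (j, i - j) else (j - 1, n + 1 + i - j)"])
    fix x assume "x \<in> {..<Suc n} \<times> {..<n}"
    then obtain j i where x: "x = (j, i)" "j \<le> n" "i < n" by auto
    show "?R (case x of (j, i) \<Rightarrow> if j \<le> i then (j, i - j) else (j - 1, n + 1 + i - j)) = ?L x"
    proof (cases "j \<le> i")
      case True
      have "even ((n - 1) * j + (i - j)) = even (n * j + i)"
        using True n x by auto
      then have "(- 1 :: 'b) ^ ((n - 1) * j + (i - j)) = (- 1) ^ (n * j + i)"
        by (simp add: uminus_power_if)
      with True x show ?thesis
        by (simp add: face_twisted_rotation_funpow_ge[OF \<tau>_mult n(1) True _ n(2)])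
    next
      case False
      have "even ((n - 1) * (j - 1) + (n + 1 + i - j)) = even (n * j + i)"
        using False n x by auto
      then have "(- 1 :: 'b) ^ ((n - 1) * (j - 1) + (n + 1 + i - j)) = (- 1) ^ (n * j + i)"
        by (simp add: uminus_power_if)
      with False x show ?thesis
        using face_twisted_rotation_funpow_less[OF \<tau>_mult n(1) _ x(2) n(2), of i] by simp
    qed
  qed (use n in \<open>auto split: if_splits\<close>)
  also have "\<dots> = (\<Sum>k<n. \<Sum>l<Suc n. ?R (k, l))"
    unfolding sum.cartesian_product by (simp add: split_beta)
  also have "\<dots> = (\<Sum>l<Suc n. \<Sum>k<n. ?R (k, l))"
    by (rule sum.swap)
  also have "\<dots> = twisted_differential (norm_op f) xs"
    unfolding norm_op_def twisted_differential_def using assms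
    by (simp add: n sum_distrib_left power_add mult_ac del: sum.lessThan_Suc)
  finally show ?thesis .
qed

text \<open>The homotopy formula on a cocycle: \<open>bar_op_homotopy\<close> for
  \<open>f - cyclic_op f\<close> leaves an error term that vanishes by the cocycle condition, and
  the norm of the rest telescopes.\<close>

lemma twisted_differential_connes_op:
  assumes len: "2 \<le> length xs"
    and cocycle: "\<And>ys. length ys = Suc (length xs) \<Longrightarrow> twisted_differential f ys = 0"
  shows "twisted_differential (connes_op f) xs = f xs - f (map \<tau> xs)"
proof -
  have ne: "xs \<noteq> []" using len by auto
  have "twisted_differential (connes_op f) xs =
      norm_op (bar_op (\<lambda>ys. f (1 # ys) - cyclic_op f (1 # ys))) xs"
    unfolding connes_op_def by (rule norm_op_bar_op[OF len, symmetric])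
  also have "\<dots> = norm_op (\<lambda>ys. f ys - cyclic_op f ys) xs"
  proof (rule norm_op_cong[OF ne])
    fix ys :: "'a list" assume ys: "length ys = length xs"
    then have "ys \<noteq> []" using ne by auto
    \<comment> \<open>Both \<open>1 # ys\<close> and its rotation have the length to which
      \<open>cocycle\<close> applies.\<close>
    have "bar_op (\<lambda>zs. f zs - cyclic_op f zs) (1 # ys) = 0"
      using len ys by (subst bar_op_one_minus_cyclic_op) (simp_all add: cocycle cyclic_op_def)
    then show "bar_op (\<lambda>zs. f (1 # zs) - cyclic_op f (1 # zs)) ys = f ys - cyclic_op f ys"
      using bar_op_homotopy[OF \<open>ys \<noteq> []\<close>, of "\<lambda>zs. f zs - cyclic_op f zs"] by simp
  qed
  also have "\<dots> = f xs - f (map \<tau> xs)" by (rule norm_op_one_minus_cyclic_op[OF ne])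
  finally show ?thesis .
qed

end

end

section \<open>Multilinear functionals\<close>

context associative_algebra
begin

text \<open>Unlike for cochains, values on lists of other lengths are left free, because the
  operators above act in all degrees at once.\<close>

definition multilinear_functional :: "nat \<Rightarrow> ('a list \<Rightarrow> 'k) \<Rightarrow> bool"
  where "multilinear_functional q f \<longleftrightarrow>
    (\<forall>xs i. length xs = q \<longrightarrow> i < q \<longrightarrow> Vector_Spaces.linear (*\<^sub>s) (*) (\<lambda>x. f (xs[i := x])))"

sublocale scalars: vector_space_pair "(*\<^sub>s)" "(*) :: 'k \<Rightarrow> 'k \<Rightarrow> 'k"
  by unfold_locales (simp_all add: algebra_simps)

lemma multilinear_functional_diff:
  assumes "multilinear_functional q f" "multilinear_functional q g"
  shows "multilinear_functional q (\<lambda>xs. f xs - g xs)"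
  using assms by (auto simp: multilinear_functional_def intro: scalars.linear_compose_sub)

lemma multilinear_functional_scale:
  assumes "multilinear_functional q f"
  shows "multilinear_functional q (\<lambda>xs. k * f xs)"
  using assms by (auto simp: multilinear_functional_def intro: scalars.linear_compose_scale_right)

lemma multilinear_functional_sum:
  assumes "\<And>j. j \<in> J \<Longrightarrow> multilinear_functional q (f j)"
  shows "multilinear_functional q (\<lambda>xs. \<Sum>j\<in>J. f j xs)"
  using assms by (auto simp: multilinear_functional_def intro: scalars.linear_compose_sum)

lemma multilinear_functional_cong:
  assumes "multilinear_functional q f" "\<And>xs. length xs = q \<Longrightarrow> f xs = g xs"
  shows "multilinear_functional q g"
  using assms by (simp add: multilinear_functional_def)

lemma multilinear_functional_Cons:
  assumes "multilinear_functional (Suc q) f"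
  shows "multilinear_functional q (\<lambda>xs. f (a # xs))"
  unfolding multilinear_functional_def
proof (intro allI impI)
  fix xs :: "'a list" and i assume "length xs = q" "i < q"
  then show "Vector_Spaces.linear (*\<^sub>s) (*) (\<lambda>x. f (a # xs[i := x]))"
    using assms[unfolded multilinear_functional_def, rule_format, of "a # xs" "Suc i"] by simp
qed

context
  fixes \<tau> :: "'a \<Rightarrow> 'a"
  assumes \<tau>_linear: "Vector_Spaces.linear (*\<^sub>s) (*\<^sub>s) \<tau>"
begin

text \<open>The last slot reaches the front through the linear map \<tau>; every other slot moves
  one place to the right.\<close>

lemma multilinear_functional_twisted_rotation:
  assumes "multilinear_functional q f"
  shows "multilinear_functional q (\<lambda>xs. f (twisted_rotation \<tau> xs))"
  unfolding multilinear_functional_def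
proof (intro allI impI)
  fix xs :: "'a list" and i assume i: "length xs = q" "i < q"
  then obtain ys z where xs: "xs = ys @ [z]" by (cases xs rule: rev_cases) auto
  have lin: "Vector_Spaces.linear (*\<^sub>s) (*) (\<lambda>x. f ((\<tau> z # ys)[j := x]))" if "j < q" for j
    using assms[unfolded multilinear_functional_def, rule_format, of "\<tau> z # ys" j] i that xs by simp
  show "Vector_Spaces.linear (*\<^sub>s) (*) (\<lambda>x. f (twisted_rotation \<tau> (xs[i := x])))"
  proof (cases "i = length ys")
    case True
    then have eq: "twisted_rotation \<tau> (xs[i := x]) = (\<tau> z # ys)[0 := \<tau> x]" for x
      by (simp add: xs twisted_rotation_def)
    have "Vector_Spaces.linear (*\<^sub>s) (*) ((\<lambda>x. f ((\<tau> z # ys)[0 := x])) \<circ> \<tau>)"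
      using i by (intro Vector_Spaces.linear_compose[OF \<tau>_linear] lin) simp
    then show ?thesis unfolding eq by (simp add: o_def)
  next
    case False
    then have "twisted_rotation \<tau> (xs[i := x]) = (\<tau> z # ys)[Suc i := x]" for x
      using i by (simp add: xs twisted_rotation_def list_update_append)
    then show ?thesis using lin[of "Suc i"] i False xs by simp
  qed
qed

lemma multilinear_functional_twisted_rotation_funpow:
  assumes "multilinear_functional q f"
  shows "multilinear_functional q (\<lambda>xs. f ((twisted_rotation \<tau> ^^ j) xs))"
proof (induction j)
  case (Suc j)
  from multilinear_functional_twisted_rotation[OF Suc] show ?case
    by (simp add: funpow_swap1)
qed (use assms in simp)

lemma multilinear_functional_cyclic_op:
  assumes "multilinear_functional q f"
  shows "multilinear_functional q (cyclic_op \<tau> f)"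
  by (rule multilinear_functional_cong[OF multilinear_functional_scale[
        OF multilinear_functional_twisted_rotation[OF assms], of "(- 1) ^ (q - 1)"]])
    (simp add: cyclic_op_def)

lemma multilinear_functional_norm_op:
  assumes "multilinear_functional q f"
  shows "multilinear_functional q (norm_op \<tau> f)"
proof (rule multilinear_functional_cong)
  show "multilinear_functional q
      (\<lambda>xs. \<Sum>j<q. (- 1) ^ ((q - 1) * j) * f ((twisted_rotation \<tau> ^^ j) xs))"
    by (intro multilinear_functional_sum multilinear_functional_scale
        multilinear_functional_twisted_rotation_funpow assms)
qed (simp add: norm_op_def)

lemma multilinear_functional_connes_op:
  assumes "multilinear_functional (Suc q) f"
  shows "multilinear_functional q (connes_op \<tau> f)"
  unfolding connes_op_def
  by (intro multilinear_functional_norm_op multilinear_functional_diff multilinear_functional_Cons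
      multilinear_functional_cyclic_op assms)

end

end

section \<open>Cochains of a Frobenius algebra as functionals\<close>

context frobenius_algebra
begin

definition cochain_functional :: "('a list \<Rightarrow> 'a) \<Rightarrow> 'a list \<Rightarrow> 'k"
  where "cochain_functional c xs = form (hd xs) (c (tl xs))"

lemma cochain_functional_Cons [simp]: "cochain_functional c (x # ys) = form x (c ys)"
  by (simp add: cochain_functional_def)

lemma form_zero_right: "form a 0 = 0"
  using form_diff_right[of a 0 0] by simp

lemma form_minus_right: "form a (- b) = - form a b"
  using form_diff_right[of a 0 b] by (simp add: form_zero_right)

lemma form_sum_right: "form a (\<Sum>i\<in>I. g i) = (\<Sum>i\<in>I. form a (g i))"
  by (induction I rule: infinite_finite_induct) (simp_all add: form_zero_right form_add_right)

lemma multilinear_functional_cochain_functional: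
  assumes "c \<in> hochschild_cochains (*\<^sub>s) p"
  shows "multilinear_functional (Suc p) (cochain_functional c)"
  unfolding multilinear_functional_def
proof (intro allI impI)
  fix xs :: "'a list" and i assume i: "length xs = Suc p" "i < Suc p"
  then obtain a ys where xs: "xs = a # ys" "length ys = p" by (cases xs) auto
  show "Vector_Spaces.linear (*\<^sub>s) (*) (\<lambda>x. cochain_functional c (xs[i := x]))"
  proof (cases i)
    case 0
    then show ?thesis by (simp add: xs form_linear_left)
  next
    case (Suc j)
    then have "Vector_Spaces.linear (*\<^sub>s) (*\<^sub>s) (\<lambda>x. c (ys[j := x]))"
      using assms i xs by (simp add: hochschild_cochains_def)
    from Vector_Spaces.linear_compose[OF this form_linear_right[of a]]
    show ?thesis by (simp add: xs Suc o_def)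
  qed
qed

text \<open>The form represents the dependence on the first argument by a vector, and its uniqueness
  makes that vector multilinear in the remaining arguments.\<close>

lemma multilinear_functional_represented:
  assumes "multilinear_functional (Suc p) f"
  obtains c where "c \<in> hochschild_cochains (*\<^sub>s) p"
    "\<And>xs. length xs = Suc p \<Longrightarrow> cochain_functional c xs = f xs"
proof -
  \<comment> \<open>The head of \<open>0 # ys\<close> is a placeholder, overwritten by the update at
    position 0.\<close>
  have "\<exists>y. \<forall>b. f (b # ys) = form b y" if "length ys = p" for ys
    using assms[unfolded multilinear_functional_def, rule_format, of "0 # ys" 0] that
    by (intro form_represents) simp
  then obtain c0 where c0: "length ys = p \<Longrightarrow> f (b # ys) = form b (c0 ys)" for ys b
    by metis
  define c where "c ys = (if length ys = p then c0 ys else 0)" for ys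
  have c: "form b (c ys) = f (b # ys)" if "length ys = p" for ys b
    using c0 that by (simp add: c_def)
  have "Vector_Spaces.linear (*\<^sub>s) (*\<^sub>s) (\<lambda>x. c (ys[i := x]))" if ys: "length ys = p" "i < p" for ys i
  proof -
    have lin: "Vector_Spaces.linear (*\<^sub>s) (*) (\<lambda>x. f (b # ys[i := x]))" for b
      using assms[unfolded multilinear_functional_def, rule_format, of "b # ys" "Suc i"] ys by simp
    show ?thesis
    proof unfold_locales
      show "c (ys[i := x + y]) = c (ys[i := x]) + c (ys[i := y])" for x y
        by (rule form_eq_right) (use ys in \<open>simp add: c form_add_right scalars.linear_add[OF lin]\<close>)
      show "c (ys[i := k *\<^sub>s x]) = k *\<^sub>s c (ys[i := x])" for k x
        by (rule form_eq_right) (use ys in \<open>simp add: c form_scale_right scalars.linear_scale[OF lin]\<close>)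
    qed
  qed
  then have "c \<in> hochschild_cochains (*\<^sub>s) p" by (simp add: hochschild_cochains_def c_def)
  moreover have "cochain_functional c xs = f xs" if "length xs = Suc p" for xs
    using that c by (cases xs) auto
  ultimately show thesis by (rule that)
qed

section \<open>The Nakayama twist and the homotopy on cochains\<close>

context
  fixes \<sigma> :: "'a \<Rightarrow> 'a"
  assumes \<sigma>: "nakayama_automorphism (*\<^sub>s) form \<sigma>"
begin

lemma nakayama_algebra_automorphism: "algebra_automorphism (*\<^sub>s) \<sigma>"
  using \<sigma> by (simp add: nakayama_automorphism_def)

lemmas nakayama_inv_f = automorphism_inv_f[OF nakayama_algebra_automorphism]

lemma form_nakayama: "form a b = form b (\<sigma> a)"
  using \<sigma> by (simp add: nakayama_automorphism_def)

lemma form_inv_nakayama: "form (inv \<sigma> a) b = form b a"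
  by (simp add: form_nakayama[of "inv \<sigma> a"] nakayama_inv_f)

text \<open>The source of the twist in the last face: a right factor in the second slot of the form
  returns on the left of the first slot after applying \<open>inv \<sigma>\<close>.\<close>

lemma form_mult_right_nakayama: "form a (b * c) = form (inv \<sigma> c * a) b"
  by (simp add: form_inv_nakayama form_assoc)

text \<open>Face 0 comes from associativity of the form, the inner faces from the sum with indices
  shifted by the extra argument \<open>a\<close>, the last face from
  \<open>form_mult_right_nakayama\<close>.\<close>

lemma cochain_functional_differential:
  assumes "length xs = p + 2"
  shows "cochain_functional (hochschild_differential (*\<^sub>s) p c) xs =
    twisted_differential (inv \<sigma>) (cochain_functional c) xs"
proof -
  obtain a ys where xs: "xs = a # ys" and ys: "length ys = Suc p" using assms by (cases xs) auto
  then have ne: "ys \<noteq> []" by auto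
  have "twisted_differential (inv \<sigma>) (cochain_functional c) xs =
    form (a * hd ys) (c (tl ys))
    + (\<Sum>i<p. (- 1) ^ (i + 1) * form a (c (face (inv \<sigma>) i ys)))
    + (- 1) ^ (p + 1) * form (inv \<sigma> (last ys) * a) (c (butlast ys))"
  proof -
    have "face (inv \<sigma>) 0 xs = a * hd ys # tl ys"
      using ne by (cases ys) (simp_all add: xs face_def)
    moreover have "face (inv \<sigma>) (Suc p) xs = inv \<sigma> (last ys) * a # butlast ys"
      using ne ys by (simp add: xs face_def)
    moreover have "face (inv \<sigma>) (Suc i) xs = a # face (inv \<sigma>) i ys" if "i < p" for i
      using ys that by (simp add: xs face_Cons)
    moreover have "length xs = Suc (Suc p)" using assms by simp
    ultimately show ?thesis
      unfolding twisted_differential_def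
      by (simp add: sum.lessThan_Suc[of _ "Suc p"] sum.lessThan_Suc_shift[of _ p] del: sum.lessThan_Suc)
  qed
  also have "\<dots> = cochain_functional (hochschild_differential (*\<^sub>s) p c) xs"
    using ys by (simp add: xs hochschild_differential_def form_add_right form_diff_right
        form_minus_right form_sum_right form_scale_right face_def form_assoc[of a "hd ys"]
        form_mult_right_nakayama[of a "c (butlast ys)"])
  finally show ?thesis by simp
qed

text \<open>Using \<open>form_nakayama\<close> twice shows that the form is invariant under
  \<sigma>, so the outer \<sigma> becomes \<open>inv \<sigma>\<close> on the first argument.\<close>

lemma cochain_functional_conj:
  assumes "xs \<noteq> []"
  shows "cochain_functional (conj_cochain \<sigma> c) xs = cochain_functional c (map (inv \<sigma>) xs)"
  using assms by (cases xs) (simp_all add: conj_cochain_def form_inv_nakayama flip: form_nakayama)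

lemma conj_cochain_nakayama_cohomologous:
  assumes c: "c \<in> hochschild_cocycles (*\<^sub>s) p"
  shows "(c, conj_cochain \<sigma> c) \<in> cohomologous (*\<^sub>s) p"
proof -
  have cc: "c \<in> hochschild_cochains (*\<^sub>s) p" and dc: "hochschild_differential (*\<^sub>s) p c = (\<lambda>_. 0)"
    using c by (auto simp: hochschild_cocycles_def)
  have conj: "conj_cochain \<sigma> c \<in> hochschild_cocycles (*\<^sub>s) p"
    by (rule conj_cochain_in_cocycles[OF nakayama_algebra_automorphism c])
  then have diff: "(\<lambda>xs. c xs - conj_cochain \<sigma> c xs) \<in> hochschild_cochains (*\<^sub>s) p"
    using cc by (intro hochschild_cochains_diff) (auto simp: hochschild_cocycles_def)
  have cocycle: "twisted_differential (inv \<sigma>) (cochain_functional c) ys = 0" if "length ys = p + 2" for ys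
    using cochain_functional_differential[OF that, of c]
    by (simp add: dc cochain_functional_def form_zero_right)
  have "(\<lambda>xs. c xs - conj_cochain \<sigma> c xs) \<in> hochschild_coboundaries (*\<^sub>s) p"
  proof (cases p)
    case 0
    have "form a (c []) = form a (\<sigma> (c []))" for a
    proof -
      \<comment> \<open>In degree 0 the cocycle must be fixed itself. The two faces of
        \<open>[1, a]\<close> are \<open>[a]\<close> and \<open>[inv \<sigma> a]\<close>.\<close>
      have "form a (c []) = form (inv \<sigma> a) (c [])"
        using cocycle[of "[1, a]"] 0 by (simp add: twisted_differential_def face_def numeral_2_eq_2)
      then show ?thesis by (simp add: form_inv_nakayama flip: form_nakayama)
    qed
    then have "\<sigma> (c []) = c []" by (rule form_eq_right[symmetric])
    then have nil: "c [] - conj_cochain \<sigma> c [] = 0" by (simp add: conj_cochain_def)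
    have "c xs - conj_cochain \<sigma> c xs = 0" for xs
    proof (cases "xs = []")
      case False
      then show ?thesis using diff 0 unfolding hochschild_cochains_def by blast
    qed (simp only: nil)
    then show ?thesis by (simp add: 0 hochschild_coboundaries_def)
  next
    case (Suc q)
    \<comment> \<open>Connes' operator lowers the degree by one; the cochain \<open>h\<close>
      representing its value has the difference of the two cocycles as its coboundary.\<close>
    have "multilinear_functional (Suc q) (connes_op (inv \<sigma>) (cochain_functional c))"
      using multilinear_functional_cochain_functional[OF cc] Suc
      by (intro multilinear_functional_connes_op
          automorphism_inv_linear[OF nakayama_algebra_automorphism]) simp
    then obtain h where h: "h \<in> hochschild_cochains (*\<^sub>s) q"
      and h_eq: "\<And>xs. length xs = Suc q \<Longrightarrow>
        cochain_functional h xs = connes_op (inv \<sigma>) (cochain_functional c) xs"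
      using multilinear_functional_represented by blast
    have "c xs - conj_cochain \<sigma> c xs = hochschild_differential (*\<^sub>s) q h xs" for xs
    proof (cases "length xs = p")
      case True
      show ?thesis
      proof (rule form_eq_right)
        fix a
        have len: "length (a # xs) = q + 2" using True Suc by simp
        have "form a (hochschild_differential (*\<^sub>s) q h xs) =
            twisted_differential (inv \<sigma>) (cochain_functional h) (a # xs)"
          using cochain_functional_differential[OF len, of h] by simp
        also have "\<dots> = twisted_differential (inv \<sigma>) (connes_op (inv \<sigma>) (cochain_functional c)) (a # xs)"
          using len by (simp add: twisted_differential_def h_eq)
        also have "\<dots> = cochain_functional c (a # xs) - cochain_functional c (map (inv \<sigma>) (a # xs))"
          using len Suc
          by (intro twisted_differential_connes_op cocycle
              automorphism_inv_mult[OF nakayama_algebra_automorphism]) simp_all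
        also have "\<dots> = form a (c xs - conj_cochain \<sigma> c xs)"
          using cochain_functional_conj[of "a # xs" c] by (simp add: form_diff_right)
        finally show "form a (c xs - conj_cochain \<sigma> c xs) =
          form a (hochschild_differential (*\<^sub>s) q h xs)" by simp
      qed
    next
      case False
      then have "c xs - conj_cochain \<sigma> c xs = 0"
        using diff unfolding hochschild_cochains_def by blast
      with False Suc show ?thesis by (simp add: hochschild_differential_def)
    qed
    then show ?thesis using h by (simp add: Suc hochschild_coboundaries_def)
  qed
  then show ?thesis using c conj by (simp add: cohomologous_def)
qed

end

end

section \<open>Passage from cocycles to cohomology classes\<close>

theorem theorem1:
  fixes scale :: "'k::field \<Rightarrow> 'a::{ring,monoid_mult} \<Rightarrow> 'a"
    and form :: "'a \<Rightarrow> 'a \<Rightarrow> 'k"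
    and \<sigma> :: "'a \<Rightarrow> 'a"
  assumes "frobenius_algebra scale form"
    and "nakayama_automorphism scale form \<sigma>"
  shows "\<forall>p. \<forall>\<xi> \<in> hochschild_cohomology scale p. hochschild_action scale p \<sigma> \<xi> = \<xi>"
proof (intro allI ballI)
  fix p \<xi> assume "\<xi> \<in> hochschild_cohomology scale p"
  then obtain c where c: "c \<in> hochschild_cocycles scale p" and \<xi>: "\<xi> = cohomologous scale p `` {c}"
    unfolding hochschild_cohomology_def by (rule quotientE)
  interpret frobenius_algebra scale form by (rule assms(1))
  have "hochschild_action scale p \<sigma> \<xi> = cohomologous scale p `` {conj_cochain \<sigma> c}"
    unfolding \<xi> by (rule hochschild_action_class[OF nakayama_algebra_automorphism[OF assms(2)] c])
  also have "\<dots> = \<xi>"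
    unfolding \<xi> using conj_cochain_nakayama_cohomologous[OF assms(2) c]
    by (rule equiv_class_eq[OF equiv_cohomologous, symmetric])
  finally show "hochschild_action scale p \<sigma> \<xi> = \<xi>" .
qed

end
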